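(* Let $q\in(0,1)$. If the trust-region radius $\Delta_k>0$ satisfies $$\Delta_k\le(1-q)\frac{\|(T_{\ell_k}^TT_{\ell_k})^{1/2}Q_{\ell_k}^Tg_k\|}{\|T_{\ell_k}^TT_{\ell_k}\|^2},$$ then the projected $q$-condition $$\|Q_{\ell_k}^Tm_k(p(\lambda_k))\|\ge q\|g_k\|$$ is satisfied, where $\lambda_k$ is the multiplier of the projected trust-region subproblem with radius $\Delta_k$ and $p(\lambda_k)$ the corresponding step, as defined in the context.
   Context: $F:\mathcal{D}(F)\subseteq\mathbb{R}^n\to\mathbb{R}^m$, $m\ge n$, is continuously differentiable with Jacobian $J$; $y^\delta\in\mathbb{R}^m$; $\|\cdot\|$ is the 2-norm. At $x_k^\delta$ set $B_k=J(x_k^\delta)^TJ(x_k^\delta)$, $g_k=J(x_k^\delta)^T(F(x_k^\delta)-y^\delta)\neq0$, $m_k(p)=B_kp+g_k$. For $1\le\ell_k\le n$, $Q_{\ell_k},T_{\ell_k}$ are the output of $\ell=\ell_k$ steps of Golub-Kahan-Lanczos bidiagonalization with $A=J(x_k^\delta)$: $q_1=g_k/\|g_k\|$, $\beta_0=0$, and for $j=1,\dots,\ell$: $\tilde p_j=Aq_j-\beta_{j-1}p_{j-1}$, $\alpha_j=\|\tilde p_j\|$, $p_j=\tilde p_j/\alpha_j$, $\tilde q_{j+1}=A^Tp_j-\alpha_jq_j$, $\beta_j=\|\tilde q_{j+1}\|$, $q_{j+1}=\tilde q_{j+1}/\beta_j$. Here $Q_{\ell}=[q_1,\dots,q_\ell]\in\mathbb{R}^{n\times\ell}$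 has orthonormal columns, and $T_\ell\in\mathbb{R}^{\ell\times\ell}$ is upper bidiagonal with diagonal $\alpha_1,\dots,\alpha_\ell$ and superdiagonal $\beta_1,\dots,\beta_{\ell-1}$. It is assumed that the process is not prematurely halted ($\alpha_j\neq0$ for $j\le\ell$, $\beta_j\ne0$ for $j<\ell$). For $\lambda\ge0$, $w(\lambda)\in\mathbb{R}^{\ell_k}$ solves $[(T_{\ell_k}^TT_{\ell_k})^2+\lambda I]w(\lambda)=-(T_{\ell_k}^TT_{\ell_k})^{1/2}Q_{\ell_k}^Tg_k$, where $Q_{\ell_k}^Tg_k=\|g_k\|e_1$ with $e_1$ the first canonical basis vector; $z(\lambda)=Q_{\ell_k}w(\lambda)$ and $p(\lambda)=Q_{\ell_k}(T_{\ell_k}^TT_{\ell_k})^{1/2}Q_{\ell_k}^Tz(\lambda)$. The multiplier $\lambda_k$ is determined by the KKT conditions $\lambda_k\ge0$, $\lambda_k(\Delta_k-\|w(\lambda_k)\|)=0$, $\|w(\lambda_k)\|\le\Delta_k$. *)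

theory Defs
  imports "HOL-Analysis.Analysis"
begin

text \<open>
  The norm of a matrix is the operator norm induced by the Euclidean norm. The library's
  \<^term>\<open>norm\<close> on the type of matrices is a different one (the Frobenius norm).
\<close>

definition op_norm :: "real^'n^'m \<Rightarrow> real" where
  "op_norm A = onorm ((*v) A)"

definition psd :: "real^'n^'n \<Rightarrow> bool" where
  "psd A \<longleftrightarrow> transpose A = A \<and> (\<forall>v. 0 \<le> v \<bullet> (A *v v))"

text \<open>
  A positive semidefinite matrix has exactly one positive semidefinite square root, so the
  description below is proper on such matrices; its value on other matrices is irrelevant.
\<close>

definition psd_sqrt :: "real^'n^'n \<Rightarrow> real^'n^'n" where
  "psd_sqrt A = (THE S. psd S \<and> S ** S = A)"

definition cont_differentiable_with ::
    "(real^'n) set \<Rightarrow> (real^'n \<Rightarrow> real^'m) \<Rightarrow> (real^'n \<Rightarrow> real^'n^'m) \<Rightarrow> bool" where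
  "cont_differentiable_with D F J \<longleftrightarrow>
     (\<forall>x\<in>D. (F has_derivative ((*v) (J x))) (at x within D)) \<and> continuous_on D J"

text \<open>
  \<open>us\<close>, \<open>vs\<close> are the sequences usually written \<open>p\<^sub>j\<close>, \<open>q\<^sub>j\<close>. They are 1-based.
  The vector \<open>us 0\<close> is unconstrained, but only occurs with the factor \<open>\<beta> 0 = 0\<close>.
  Breakdown is not excluded here: it would show up as a vanishing \<open>\<alpha> j\<close> or \<open>\<beta> j\<close>.
\<close>

definition golub_kahan_lanczos ::
    "real^'n^'m \<Rightarrow> real^'n \<Rightarrow> nat \<Rightarrow> (nat \<Rightarrow> real^'m) \<Rightarrow> (nat \<Rightarrow> real^'n) \<Rightarrow>
     (nat \<Rightarrow> real) \<Rightarrow> (nat \<Rightarrow> real) \<Rightarrow> bool" where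
  "golub_kahan_lanczos A g l us vs \<alpha> \<beta> \<longleftrightarrow>
     vs 1 = (1 / norm g) *\<^sub>R g \<and> \<beta> 0 = 0 \<and>
     (\<forall>j\<in>{1..l}.
        (let u = A *v vs j - \<beta> (j - 1) *\<^sub>R us (j - 1);
             v = transpose A *v us j - \<alpha> j *\<^sub>R vs j
         in \<alpha> j = norm u \<and> us j = (1 / \<alpha> j) *\<^sub>R u \<and>
            \<beta> j = norm v \<and> vs (j + 1) = (1 / \<beta> j) *\<^sub>R v))"

text \<open>
  An \<open>\<ell>\<close>-element index set is rendered as a finite linearly ordered type \<open>'l\<close> with
  \<open>\<ell> = CARD('l)\<close>; \<open>pos\<close> is the order isomorphism onto \<open>{1..\<ell>}\<close>.
\<close>

definition pos :: "'l::{finite,linorder} \<Rightarrow> nat" where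
  "pos i = card {..i}"

definition lanczos_Q :: "(nat \<Rightarrow> real^'n) \<Rightarrow> real^'l::{finite,linorder}^'n" where
  "lanczos_Q vs = (\<chi> i j. vs (pos j) $ i)"

definition lanczos_T :: "(nat \<Rightarrow> real) \<Rightarrow> (nat \<Rightarrow> real) \<Rightarrow> real^'l::{finite,linorder}^'l::{finite,linorder}" where
  "lanczos_T \<alpha> \<beta> =
     (\<chi> i j. if j = i then \<alpha> (pos i) else if pos j = pos i + 1 then \<beta> (pos i) else 0)"

end

theory Submission
  imports Defs
begin

text \<open>
  Write \<open>M = T\<^sup>T T\<close>, \<open>S = M\<^sup>1\<^sup>/\<^sup>2\<close>, \<open>b = Q\<^sup>T g\<close> and \<open>\<nu>\<close> for the multiplier. The bidiagonalization gives
  \<open>A Q = P T\<close>, where both \<open>P\<close> and \<open>Q\<close> have orthonormal columns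
  (\<open>lanczos_factorization\<close>, \<open>golub_kahan_lanczos_orthonormal\<close>). Hence
  \<open>Q\<^sup>T B Q = T\<^sup>T P\<^sup>T P T = M\<close>, and the projected residual \<open>Q\<^sup>T m(p(\<nu>))\<close> is
  \<open>r = M S w + b\<close>, an object of the small space only.

  Since \<open>M = S S\<close> commutes with \<open>S\<close>, multiplying \<open>r\<close> by \<open>M\<^sup>2 + \<nu> I\<close> and inserting the equation
  that defines \<open>w\<close> makes everything cancel except \<open>\<nu> b\<close>: \<open>(M\<^sup>2 + \<nu> I) r = \<nu> b\<close>
  (\<open>regularized_residual_eq\<close>). As \<open>M\<^sup>2 + \<nu> I\<close> has norm at most \<open>N + \<nu>\<close> with \<open>N = \<parallel>M\<parallel>\<^sup>2\<close>, this yields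
  \<open>\<parallel>r\<parallel> \<ge> \<nu> / (N + \<nu>) \<parallel>b\<parallel>\<close>, so it is enough that \<open>\<nu> \<ge> q (N + \<nu>)\<close>: a small radius must force a
  large multiplier. Indeed, the same norm bound applied to the equation for \<open>w\<close> gives
  \<open>\<parallel>S b\<parallel> \<le> (N + \<nu>) \<parallel>w\<parallel> \<le> (N + \<nu>) \<Delta>\<close>, and the assumed bound on \<open>\<Delta>\<close> turns this into
  \<open>N \<le> (1 - q) (N + \<nu>)\<close>, which is the inequality needed. Finally \<open>\<parallel>b\<parallel> \<ge> \<parallel>g\<parallel>\<close> because the first
  Lanczos vector is \<open>g / \<parallel>g\<parallel>\<close>.

  As \<open>S\<close> is given by a definite description, the identity \<open>S S = M\<close> rests on the existence and
  uniqueness of positive semidefinite roots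
  (\<open>ex1_psd_root\<close>), which come from an orthonormal basis of eigenvectors
  (\<open>self_adjoint_eigenvector_expansion\<close>).
\<close>

section \<open>The square root of a positive semidefinite matrix\<close>

text \<open>
  A maximizer \<open>e\<close> of the Rayleigh quotient on the unit sphere of \<open>V\<close>, with maximum \<open>\<mu>\<close>, is an
  eigenvector: the quadratic form \<open>\<mu> (x \<bullet> x) - x \<bullet> f x\<close> is nonnegative on \<open>V\<close> and vanishes at \<open>e\<close>,
  so its derivative at \<open>e\<close> vanishes in every direction of \<open>V\<close>, in particular in the direction
  \<open>r = \<mu> e - f e\<close>, where it equals \<open>2 (r \<bullet> r)\<close>.
\<close>

lemma self_adjoint_eigenvector_in_subspace:
  fixes f :: "'a::euclidean_space \<Rightarrow> 'a"
  assumes lin: "linear f" and adj: "\<And>x y. f x \<bullet> y = x \<bullet> f y"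
    and sub: "subspace V" and inv: "\<And>x. x \<in> V \<Longrightarrow> f x \<in> V" and nontriv: "\<exists>x\<in>V. x \<noteq> 0"
  obtains e \<mu> where "e \<in> V" "norm e = 1" "f e = \<mu> *\<^sub>R e"
proof -
  define C where "C = V \<inter> sphere 0 1"
  have "compact C"
    unfolding C_def using closed_subspace[OF sub] by (simp add: closed_Int_compact)
  moreover have "C \<noteq> {}"
  proof -
    obtain x where x: "x \<in> V" "x \<noteq> 0" using nontriv by blast
    have "(1 / norm x) *\<^sub>R x \<in> C"
      using x sub by (simp add: C_def subspace_scale)
    then show ?thesis by blast
  qed
  moreover have "continuous_on C (\<lambda>x. x \<bullet> f x)"
    using lin by (intro continuous_intros linear_continuous_on) (simp add: linear_conv_bounded_linear)
  ultimately obtain e where eC: "e \<in> C" and emax: "\<And>x. x \<in> C \<Longrightarrow> x \<bullet> f x \<le> e \<bullet> f e"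
    using continuous_attains_sup[of C "\<lambda>x. x \<bullet> f x"] by blast
  define \<mu> where "\<mu> = e \<bullet> f e"
  have eV: "e \<in> V" and e1: "norm e = 1" using eC by (auto simp: C_def)
  have ee: "e \<bullet> e = 1" using e1 by (simp add: norm_eq_1)
  have le: "x \<bullet> f x \<le> \<mu> * (x \<bullet> x)" if "x \<in> V" for x
  proof (cases "x = 0")
    case True
    then show ?thesis using lin by (simp add: linear_0)
  next
    case False
    have "(1 / norm x) *\<^sub>R x \<in> C"
      using that False sub by (simp add: C_def subspace_scale)
    from emax[OF this] have "(x \<bullet> f x) / (norm x * norm x) \<le> \<mu>"
      using lin by (simp add: linear_cmul \<mu>_def)
    then show ?thesis
      using False by (simp add: divide_simps power2_norm_eq_inner[symmetric] power2_eq_square)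
  qed
  define r where "r = \<mu> *\<^sub>R e - f e"
  define h where "h = \<mu> * (r \<bullet> r) - r \<bullet> f r"
  have rV: "r \<in> V"
    unfolding r_def using eV inv sub by (intro subspace_diff subspace_scale) auto
  have h0: "0 \<le> h" using le[OF rV] by (simp add: h_def)
  \<comment> \<open>Nonnegativity of the form at \<open>e - s r\<close>, expanded in powers of \<open>s\<close>; the constant term is 0.\<close>
  have step: "2 * s * (r \<bullet> r) \<le> s\<^sup>2 * h" for s
  proof -
    have V: "e - s *\<^sub>R r \<in> V"
      using eV rV sub by (intro subspace_diff subspace_scale) auto
    have fx: "f (e - s *\<^sub>R r) = f e - s *\<^sub>R f r"
      using lin by (simp add: linear_diff linear_cmul)
    have er: "e \<bullet> f r = r \<bullet> f e" using adj[of e r] by (simp add: inner_commute)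
    have rr: "r \<bullet> r = \<mu> * (r \<bullet> e) - r \<bullet> f e"
      by (subst (2) r_def) (simp add: inner_diff_right)
    have "(e - s *\<^sub>R r) \<bullet> (f e - s *\<^sub>R f r) = \<mu> - 2 * s * (r \<bullet> f e) + s\<^sup>2 * (r \<bullet> f r)"
      by (simp add: inner_diff_left inner_diff_right er \<mu>_def power2_eq_square algebra_simps)
    moreover have "(e - s *\<^sub>R r) \<bullet> (e - s *\<^sub>R r) = 1 - 2 * s * (r \<bullet> e) + s\<^sup>2 * (r \<bullet> r)"
      by (simp add: inner_diff_left inner_diff_right ee inner_commute power2_eq_square algebra_simps)
    ultimately have "\<mu> - 2 * s * (r \<bullet> f e) + s\<^sup>2 * (r \<bullet> f r)
        \<le> \<mu> * (1 - 2 * s * (r \<bullet> e) + s\<^sup>2 * (r \<bullet> r))"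
      using le[OF V] by (simp add: fx)
    then show ?thesis unfolding h_def
      by (subst rr) (simp add: algebra_simps)
  qed
  have "r = 0"
  proof (rule ccontr)
    assume "r \<noteq> 0"
    then have pos: "0 < r \<bullet> r" by simp
    \<comment> \<open>A step so short that the quadratic term cannot compensate the linear one. The summand 1
        covers the case \<open>h = 0\<close>.\<close>
    define s where "s = (r \<bullet> r) / (h + 1)"
    have s: "0 < s" "s * h \<le> r \<bullet> r" using h0 pos by (auto simp: s_def field_simps)
    have "s * (2 * (r \<bullet> r)) \<le> s * (s * h)" using step[of s] by (simp add: power2_eq_square)
    then show False using s pos by simp
  qed
  then have "f e = \<mu> *\<^sub>R e" by (simp add: r_def)
  with eV e1 show ?thesis by (rule that)
qed

text \<open>
  Spectral theorem. Take an orthonormal set of eigenvectors of largest cardinality. Its orthogonal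
  complement is invariant under \<open>f\<close>, hence trivial, since an eigenvector in it would extend the set.
\<close>

lemma self_adjoint_eigenvector_expansion:
  fixes f :: "'a::euclidean_space \<Rightarrow> 'a"
  assumes lin: "linear f" and adj: "\<And>x y. f x \<bullet> y = x \<bullet> f y"
  obtains E \<mu> where "finite E" "\<And>d e. d \<in> E \<Longrightarrow> e \<in> E \<Longrightarrow> d \<bullet> e = (if d = e then 1 else 0)"
    "\<And>e. e \<in> E \<Longrightarrow> f e = \<mu> e *\<^sub>R e" "\<And>v. v = (\<Sum>e\<in>E. (e \<bullet> v) *\<^sub>R e)"
proof -
  define P where "P E \<longleftrightarrow> finite E \<and> (\<forall>d\<in>E. \<forall>e\<in>E. d \<bullet> e = (if d = e then 1 else 0)) \<and>
    (\<forall>e\<in>E. \<exists>\<mu>. f e = \<mu> *\<^sub>R e)" for E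
  have bound: "card E < Suc (DIM('a))" if "P E" for E
  proof -
    have "pairwise orthogonal E"
      using that by (auto simp: P_def pairwise_def orthogonal_def)
    moreover have "0 \<notin> E"
      using that unfolding P_def by (metis inner_zero_left zero_neq_one)
    ultimately have "independent E" by (rule pairwise_orthogonal_independent)
    then show ?thesis using independent_card_le le_imp_less_Suc by blast
  qed
  have "P {}" by (simp add: P_def)
  then obtain E where PE: "P E" and Emax: "\<And>E'. P E' \<Longrightarrow> card E' \<le> card E"
    using ex_has_greatest_nat[of P "{}" card "Suc (DIM('a))"] bound by (metis less_imp_le)
  have fin: "finite E" and on: "\<And>d e. d \<in> E \<Longrightarrow> e \<in> E \<Longrightarrow> d \<bullet> e = (if d = e then 1 else 0)"
    using PE by (auto simp: P_def)
  obtain \<mu> where eig: "\<And>e. e \<in> E \<Longrightarrow> f e = \<mu> e *\<^sub>R e"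
    using PE unfolding P_def by metis
  define V where "V = {v. \<forall>e\<in>E. e \<bullet> v = 0}"
  have sub: "subspace V" by (auto simp: V_def subspace_def inner_add_right)
  have inv: "f v \<in> V" if "v \<in> V" for v
    using that by (auto simp: V_def adj[symmetric] eig)
  have V0: "v = 0" if "v \<in> V" for v
  proof (rule ccontr)
    assume "v \<noteq> 0"
    with that obtain e \<nu> where e: "e \<in> V" "norm e = 1" "f e = \<nu> *\<^sub>R e"
      using self_adjoint_eigenvector_in_subspace[OF lin adj sub inv] by blast
    have ee: "e \<bullet> e = 1" using e by (simp add: norm_eq_1)
    have "e \<notin> E" using e(1) ee by (auto simp: V_def)
    moreover have "P (insert e E)"
      using PE e ee \<open>e \<notin> E\<close> by (auto simp: P_def V_def inner_commute)
    ultimately show False using Emax[of "insert e E"] fin by simp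
  qed
  have "v = (\<Sum>e\<in>E. (e \<bullet> v) *\<^sub>R e)" for v
  proof -
    have "d \<bullet> (v - (\<Sum>e\<in>E. (e \<bullet> v) *\<^sub>R e)) = 0" if "d \<in> E" for d
    proof -
      have "d \<bullet> (\<Sum>e\<in>E. (e \<bullet> v) *\<^sub>R e) = (\<Sum>e\<in>E. if e = d then d \<bullet> v else 0)"
        using that by (auto simp: inner_sum_right on intro!: sum.cong)
      then show ?thesis using that fin by (simp add: inner_diff_right)
    qed
    then have "v - (\<Sum>e\<in>E. (e \<bullet> v) *\<^sub>R e) \<in> V" by (simp add: V_def)
    then show ?thesis using V0 by fastforce
  qed
  with fin on eig show ?thesis by (rule that)
qed

text \<open>
  This determines a positive semidefinite root on an eigenbasis, hence gives uniqueness. From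
  \<open>(S + \<surd>\<mu>) (S - \<surd>\<mu>) e = 0\<close> the vector \<open>u = (S - \<surd>\<mu>) e\<close> satisfies \<open>S u = - \<surd>\<mu> u\<close>, which positivity
  of \<open>S\<close> permits only if \<open>u = 0\<close> or \<open>\<mu> = 0\<close>; in the latter case \<open>\<parallel>S e\<parallel>\<^sup>2 = e \<bullet> M e = 0\<close>.
\<close>

lemma psd_root_eigenvector:
  assumes S: "psd S" and SS: "S ** S = M"
    and eig: "M *v e = \<mu> *\<^sub>R e" and \<mu>: "0 \<le> \<mu>"
  shows "S *v e = sqrt \<mu> *\<^sub>R e"
proof -
  have sym: "(S *v x) \<bullet> y = x \<bullet> (S *v y)" for x y
    using S by (metis psd_def dot_lmul_matrix vector_transpose_matrix)
  have SSe: "S *v (S *v e) = \<mu> *\<^sub>R e"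
    using eig SS by (simp add: matrix_vector_mul_assoc)
  define u where "u = S *v e - sqrt \<mu> *\<^sub>R e"
  have "S *v u = - sqrt \<mu> *\<^sub>R u"
    using \<mu> by (simp add: u_def matrix_vector_mult_diff_distrib matrix_vector_mult_scaleR SSe
        scaleR_diff_right)
  then have "0 \<le> u \<bullet> (- sqrt \<mu> *\<^sub>R u)"
    using S unfolding psd_def by metis
  then have "sqrt \<mu> * (u \<bullet> u) \<le> 0" by simp
  then have "\<mu> = 0 \<or> u = 0"
    using \<mu> inner_ge_zero[of u] by (auto simp: mult_le_0_iff simp del: inner_ge_zero)
  then have "u = 0"
  proof
    assume "\<mu> = 0"
    then have "(S *v e) \<bullet> (S *v e) = 0" by (simp add: sym SSe)
    then show "u = 0" using \<open>\<mu> = 0\<close> by (simp add: u_def)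
  qed
  then show ?thesis by (simp add: u_def)
qed

lemma ex1_psd_root:
  fixes M :: "real^'n^'n"
  assumes M: "psd M"
  shows "\<exists>!S. psd S \<and> S ** S = M"
proof -
  have sym: "(M *v x) \<bullet> y = x \<bullet> (M *v y)" for x y
    using M by (metis psd_def dot_lmul_matrix vector_transpose_matrix)
  obtain E \<mu> where fin: "finite E"
    and on: "\<And>d e. d \<in> E \<Longrightarrow> e \<in> E \<Longrightarrow> d \<bullet> e = (if d = e then 1 else 0)"
    and eig: "\<And>e. e \<in> E \<Longrightarrow> M *v e = \<mu> e *\<^sub>R e"
    and expand: "\<And>v. v = (\<Sum>e\<in>E. (e \<bullet> v) *\<^sub>R e)"
    by (rule self_adjoint_eigenvector_expansion[OF matrix_vector_mul_linear[of M] sym]) blast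
  have \<mu>: "0 \<le> \<mu> e" if "e \<in> E" for e
  proof -
    have "0 \<le> e \<bullet> (M *v e)" using M by (simp add: psd_def)
    then show ?thesis using that by (simp add: eig on)
  qed
  have eqI: "R = R'" if "\<And>e. e \<in> E \<Longrightarrow> R *v e = R' *v e" for R R' :: "real^'n^'n"
  proof -
    have "R *v v = R' *v v" for v
    proof -
      have "R *v v = (\<Sum>e\<in>E. (e \<bullet> v) *\<^sub>R (R *v e))"
        by (subst expand[of v]) (simp add: matrix_vector_mult_scaleR
            linear_sum[OF matrix_vector_mul_linear])
      also have "\<dots> = (\<Sum>e\<in>E. (e \<bullet> v) *\<^sub>R (R' *v e))" using that by simp
      also have "\<dots> = R' *v v"
        by (subst (2) expand[of v]) (simp add: matrix_vector_mult_scaleR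
            linear_sum[OF matrix_vector_mul_linear])
      finally show ?thesis .
    qed
    then show ?thesis by (simp add: matrix_eq)
  qed
  define f where "f v = (\<Sum>e\<in>E. (sqrt (\<mu> e) * (e \<bullet> v)) *\<^sub>R e)" for v
  define S where "S = matrix f"
  have "linear f"
    by (rule linearI) (simp_all add: f_def inner_add_right algebra_simps sum.distrib scaleR_sum_right)
  then have Sv: "S *v v = f v" for v by (simp add: S_def matrix_works)
  have Se: "S *v e = sqrt (\<mu> e) *\<^sub>R e" if "e \<in> E" for e
  proof -
    have "f e = (\<Sum>d\<in>E. if d = e then sqrt (\<mu> e) *\<^sub>R e else 0)"
      unfolding f_def using that by (intro sum.cong) (auto simp: on)
    then show ?thesis using that fin by (simp add: Sv)
  qed
  have "transpose S = S"
  proof -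
    have fsym: "f v \<bullet> u = v \<bullet> f u" for u v
      by (simp add: f_def inner_sum_left inner_sum_right inner_commute mult.commute mult.left_commute)
    have "u \<bullet> (transpose S *v v) = u \<bullet> (S *v v)" for u v
      using fsym[of u v] by (metis Sv dot_lmul_matrix vector_transpose_matrix transpose_transpose)
    then have "transpose S *v v = S *v v" for v by (metis vector_eq_rdot inner_commute)
    then show ?thesis by (simp add: matrix_eq)
  qed
  moreover have "0 \<le> v \<bullet> (S *v v)" for v
    unfolding Sv f_def inner_sum_right
    using \<mu> by (intro sum_nonneg) (simp add: inner_commute mult.assoc)
  ultimately have "psd S" by (simp add: psd_def)
  moreover have "S ** S = M"
  proof (rule eqI)
    fix e assume "e \<in> E"
    then show "(S ** S) *v e = M *v e"
      using \<mu> by (simp add: matrix_vector_mul_assoc[symmetric] Se matrix_vector_mult_scaleR eig)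
  qed
  ultimately show ?thesis
  proof (intro ex1I[of _ S] conjI)
    fix R assume R: "psd R \<and> R ** R = M"
    show "R = S"
    proof (rule eqI)
      fix e assume "e \<in> E"
      then show "R *v e = S *v e"
        using R psd_root_eigenvector[of R M e "\<mu> e"] by (simp add: Se eig \<mu>)
    qed
  qed auto
qed

lemma psd_sqrt_square: "psd M \<Longrightarrow> psd_sqrt M ** psd_sqrt M = M"
  unfolding psd_sqrt_def using theI'[OF ex1_psd_root] by blast

lemma psd_gram: "psd (transpose T ** T)"
  unfolding psd_def
proof (intro conjI allI)
  show "transpose (transpose T ** T) = transpose T ** T"
    by (simp add: matrix_transpose_mul)
  fix v
  have "v \<bullet> ((transpose T ** T) *v v) = (T *v v) \<bullet> (T *v v)"
    by (metis dot_lmul_matrix matrix_vector_mul_assoc vector_transpose_matrix inner_commute)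
  then show "0 \<le> v \<bullet> ((transpose T ** T) *v v)" by simp
qed

section \<open>The Golub-Kahan-Lanczos process\<close>

lemma bij_betw_pos: "bij_betw (pos :: 'l::{finite,linorder} \<Rightarrow> nat) UNIV {1..CARD('l)}"
proof -
  have "inj (pos :: 'l \<Rightarrow> nat)"
  proof (rule injI)
    fix i j :: 'l
    assume eq: "pos i = pos j"
    have "{..i} \<subset> {..j} \<Longrightarrow> False" "{..j} \<subset> {..i} \<Longrightarrow> False"
      using eq psubset_card_mono[of "{..j}" "{..i}"] psubset_card_mono[of "{..i}" "{..j}"]
      by (auto simp: pos_def)
    then show "i = j" by (metis atMost_subset_iff linear psubsetI atMost_eq_iff)
  qed
  moreover have "range (pos :: 'l \<Rightarrow> nat) \<subseteq> {1..CARD('l)}"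
    by (auto simp: pos_def card_mono Suc_le_eq card_gt_0_iff)
  ultimately show ?thesis
    by (simp add: bij_betw_def card_image card_subset_eq)
qed

text \<open>
  The first two equations hold also at a breakdown: if a normalizing factor vanishes, so does the
  vector that it is the norm of.
\<close>

lemma golub_kahan_lanczos_recurrences:
  assumes "golub_kahan_lanczos A g l us vs \<alpha> \<beta>" and "1 \<le> j" "j \<le> l"
  shows "A *v vs j = \<alpha> j *\<^sub>R us j + \<beta> (j - 1) *\<^sub>R us (j - 1)"
    and "transpose A *v us j = \<alpha> j *\<^sub>R vs j + \<beta> j *\<^sub>R vs (j + 1)"
    and "\<alpha> j \<noteq> 0 \<Longrightarrow> norm (us j) = 1"
    and "\<beta> j \<noteq> 0 \<Longrightarrow> norm (vs (j + 1)) = 1"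
proof -
  define u where "u = A *v vs j - \<beta> (j - 1) *\<^sub>R us (j - 1)"
  define v where "v = transpose A *v us j - \<alpha> j *\<^sub>R vs j"
  have *: "\<alpha> j = norm u" "us j = (1 / \<alpha> j) *\<^sub>R u" "\<beta> j = norm v" "vs (j + 1) = (1 / \<beta> j) *\<^sub>R v"
    using assms unfolding golub_kahan_lanczos_def Let_def u_def v_def by auto
  have "u = \<alpha> j *\<^sub>R us j" and "v = \<beta> j *\<^sub>R vs (j + 1)"
    using * by auto
  then show "A *v vs j = \<alpha> j *\<^sub>R us j + \<beta> (j - 1) *\<^sub>R us (j - 1)"
    and "transpose A *v us j = \<alpha> j *\<^sub>R vs j + \<beta> j *\<^sub>R vs (j + 1)"
    by (simp_all add: u_def v_def algebra_simps)
  show "\<alpha> j \<noteq> 0 \<Longrightarrow> norm (us j) = 1" using * by simp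
  show "\<beta> j \<noteq> 0 \<Longrightarrow> norm (vs (j + 1)) = 1" using * by simp
qed

text \<open>
  The process orthogonalizes each new vector against one predecessor only. Orthogonality to
  the others follows by moving \<open>A\<close> across the inner product and using the other recurrence, which
  involves only two neighbouring vectors. The two families must be treated together, in the order
  \<open>vs 1\<close>, \<open>us 1\<close>, \<open>vs 2\<close>, \<open>us 2\<close>, and so on, so that each index adds first a \<open>vs\<close> and then a \<open>us\<close>.
\<close>

lemma golub_kahan_lanczos_orthonormal:
  assumes gkl: "golub_kahan_lanczos A g l us vs \<alpha> \<beta>" and g: "g \<noteq> 0"
    and \<alpha>: "\<And>j. 1 \<le> j \<Longrightarrow> j \<le> l \<Longrightarrow> \<alpha> j \<noteq> 0"
    and \<beta>: "\<And>j. 1 \<le> j \<Longrightarrow> j < l \<Longrightarrow> \<beta> j \<noteq> 0"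
    and "i \<in> {1..l}" "j \<in> {1..l}"
  shows "us i \<bullet> us j = (if i = j then 1 else 0)"
    and "vs i \<bullet> vs j = (if i = j then 1 else 0)"
proof -
  note rec = golub_kahan_lanczos_recurrences[OF gkl]
  have v1: "vs 1 = (1 / norm g) *\<^sub>R g" and b0: "\<beta> 0 = 0"
    using gkl by (auto simp: golub_kahan_lanczos_def)
  have dual: "(A *v a) \<bullet> b = a \<bullet> (transpose A *v b)" for a b
    by (metis dot_lmul_matrix vector_transpose_matrix transpose_transpose)
  have nu: "us k \<bullet> us k = 1" if "k \<in> {1..l}" for k
    using rec(3)[of k] \<alpha>[of k] that by (simp add: norm_eq_1)
  have nv: "vs k \<bullet> vs k = 1" if "k \<in> {1..l}" for k
  proof (cases "k = 1")
    case True
    then have "norm (vs k) = 1" using g v1 by simp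
    then show ?thesis by (simp add: norm_eq_1)
  next
    case False
    then have k: "1 \<le> k - 1" "k - 1 < l" "k - 1 + 1 = k" using that by auto
    then have "norm (vs k) = 1" using rec(4)[of "k - 1"] \<beta>[of "k - 1"] by simp
    then show ?thesis by (simp add: norm_eq_1)
  qed
  have orth: "k \<le> l \<Longrightarrow> (\<forall>i\<in>{1..k}. \<forall>j\<in>{1..k}. us i \<bullet> us j = (if i = j then 1 else 0)) \<and>
      (\<forall>i\<in>{1..k}. \<forall>j\<in>{1..k}. vs i \<bullet> vs j = (if i = j then 1 else 0))" for k
  proof (induction k)
    case 0
    then show ?case by simp
  next
    case (Suc k)
    then have U: "\<And>i j. i \<in> {1..k} \<Longrightarrow> j \<in> {1..k} \<Longrightarrow> us i \<bullet> us j = (if i = j then 1 else 0)"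
      and V: "\<And>i j. i \<in> {1..k} \<Longrightarrow> j \<in> {1..k} \<Longrightarrow> vs i \<bullet> vs j = (if i = j then 1 else 0)"
      by auto
    have newv: "vs (Suc k) \<bullet> vs i = 0" if i: "i \<in> {1..k}" for i
    proof -
      have k: "1 \<le> k" "k \<le> l" "k < l" using i Suc.prems by auto
      have "\<beta> k * (vs (Suc k) \<bullet> vs i) = (transpose A *v us k) \<bullet> vs i - \<alpha> k * (vs k \<bullet> vs i)"
        using rec(2)[OF k(1,2)] by (simp add: inner_add_left)
      also have "(transpose A *v us k) \<bullet> vs i = us k \<bullet> (A *v vs i)"
        using dual[of "vs i" "us k"] by (simp add: inner_commute)
      also have "\<dots> = \<alpha> i * (us k \<bullet> us i) + \<beta> (i - 1) * (us k \<bullet> us (i - 1))"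
        using rec(1)[of i] i k by (simp add: inner_add_right)
      also have "\<beta> (i - 1) * (us k \<bullet> us (i - 1)) = 0"
      proof (cases "i = 1")
        case False
        then have "i - 1 \<in> {1..k}" "k \<noteq> i - 1" using i by auto
        then show ?thesis using U[of k "i - 1"] k by simp
      qed (simp add: b0)
      finally have "\<beta> k * (vs (Suc k) \<bullet> vs i) = 0"
        using i k by (simp add: U V split: if_splits)
      then show ?thesis using \<beta>[OF k(1,3)] by simp
    qed
    have V': "vs i \<bullet> vs j = (if i = j then 1 else 0)" if "i \<in> {1..Suc k}" "j \<in> {1..Suc k}" for i j
      using that V[of i j] newv[of i] newv[of j] nv[of "Suc k"] Suc.prems
      by (cases "i = Suc k"; cases "j = Suc k") (auto simp: inner_commute)
    have newu: "us (Suc k) \<bullet> us i = 0" if i: "i \<in> {1..k}" for i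
    proof -
      have k: "1 \<le> Suc k" "Suc k \<le> l" using Suc.prems by auto
      have "\<alpha> (Suc k) * (us (Suc k) \<bullet> us i) = (A *v vs (Suc k)) \<bullet> us i - \<beta> k * (us k \<bullet> us i)"
        using rec(1)[OF k] by (simp add: inner_add_left)
      also have "(A *v vs (Suc k)) \<bullet> us i = vs (Suc k) \<bullet> (transpose A *v us i)" by (rule dual)
      also have "\<dots> = \<alpha> i * (vs (Suc k) \<bullet> vs i) + \<beta> i * (vs (Suc k) \<bullet> vs (Suc i))"
        using rec(2)[of i] i k by (simp add: inner_add_right)
      finally have "\<alpha> (Suc k) * (us (Suc k) \<bullet> us i) = 0"
        using i by (simp add: U V' split: if_splits)
      then show ?thesis using \<alpha>[OF k] by simp
    qed
    have U': "us i \<bullet> us j = (if i = j then 1 else 0)" if "i \<in> {1..Suc k}" "j \<in> {1..Suc k}" for i j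
      using that U[of i j] newu[of i] newu[of j] nu[of "Suc k"] Suc.prems
      by (cases "i = Suc k"; cases "j = Suc k") (auto simp: inner_commute)
    show ?case using U' V' by blast
  qed
  show "us i \<bullet> us j = (if i = j then 1 else 0)" "vs i \<bullet> vs j = (if i = j then 1 else 0)"
    using orth[OF order_refl] assms(5,6) by blast+
qed

lemma lanczos_Q_orthonormal:
  fixes vs :: "nat \<Rightarrow> real^'n"
  assumes "\<And>i j. i \<in> {1..CARD('l)} \<Longrightarrow> j \<in> {1..CARD('l)} \<Longrightarrow> vs i \<bullet> vs j = (if i = j then 1 else 0)"
  shows "transpose (lanczos_Q vs) ** (lanczos_Q vs :: real^'l::{finite,linorder}^'n) = mat 1"
proof -
  have r: "pos i \<in> {1..CARD('l)}" for i :: 'l using bij_betw_pos by (auto simp: bij_betw_def)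
  have inj: "pos i = pos j \<longleftrightarrow> i = j" for i j :: 'l
    using bij_betw_pos[where 'l='l] by (auto simp: bij_betw_def inj_def)
  have "(transpose (lanczos_Q vs) ** (lanczos_Q vs :: real^'l::{finite,linorder}^'n)) $ i $ j
      = vs (pos i) \<bullet> vs (pos j)" for i j :: 'l
    by (simp add: matrix_matrix_mult_def transpose_def lanczos_Q_def inner_vec_def)
  then show ?thesis
    using assms[OF r r] by (simp add: vec_eq_iff mat_def inj)
qed

lemma lanczos_factorization:
  fixes A :: "real^'n^'m"
  assumes gkl: "golub_kahan_lanczos A g CARD('l) us vs \<alpha> \<beta>"
  shows "A ** (lanczos_Q vs :: real^'l::{finite,linorder}^'n) = lanczos_Q us ** lanczos_T \<alpha> \<beta>"
proof -
  let ?L = "CARD('l)"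
  have b0: "\<beta> 0 = 0" using gkl by (auto simp: golub_kahan_lanczos_def)
  have "(A ** (lanczos_Q vs :: real^'l::{finite,linorder}^'n)) $ r $ j 
      = (lanczos_Q us ** lanczos_T \<alpha> \<beta>) $ r $ j" for r and j :: 'l
  proof -
    define c where "c k = (if pos j = k then \<alpha> k else if pos j = k + 1 then \<beta> k else 0)" for k
    have inj: "pos i = pos j \<longleftrightarrow> i = j" for i j :: 'l
      using bij_betw_pos[where 'l='l] by (auto simp: bij_betw_def inj_def)
    have j: "1 \<le> pos j" "pos j \<le> ?L" using bij_betw_pos[where 'l='l] by (auto simp: bij_betw_def)
    have "(lanczos_Q us ** lanczos_T \<alpha> \<beta>) $ r $ j = (\<Sum>k\<in>UNIV. us (pos (k::'l)) $ r * c (pos k))"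
      by (simp add: matrix_matrix_mult_def lanczos_Q_def lanczos_T_def c_def inj)
    also have "\<dots> = (\<Sum>k\<in>{1..?L}. us k $ r * c k)"
      using sum.reindex_bij_betw[OF bij_betw_pos[where 'l='l], of "\<lambda>k. us k $ r * c k"] by simp
    \<comment> \<open>The index 0 contributes nothing as \<open>\<beta> 0 = 0\<close>; with it, \<open>pos j - 1\<close> is always in range and the
        first column needs no separate treatment.\<close>
    also have "\<dots> = (\<Sum>k\<in>{0..?L}. us k $ r * c k)"
      using b0 j by (simp add: sum.atLeast_Suc_atMost c_def)
    also have "\<dots> = (\<Sum>k\<in>{pos j, pos j - 1}. us k $ r * c k)"
      using j by (intro sum.mono_neutral_right) (auto simp: c_def)
    also have "\<dots> = (\<alpha> (pos j) *\<^sub>R us (pos j) + \<beta> (pos j - 1) *\<^sub>R us (pos j - 1)) $ r"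
      using j by (auto simp: c_def)
    also have "\<dots> = (A *v vs (pos j)) $ r"
      using golub_kahan_lanczos_recurrences(1)[OF gkl j] by simp
    also have "\<dots> = (A ** (lanczos_Q vs :: real^'l::{finite,linorder}^'n)) $ r $ j"
      by (simp add: matrix_matrix_mult_def matrix_vector_mult_def lanczos_Q_def)
    finally show ?thesis by simp
  qed
  then show ?thesis by (simp add: vec_eq_iff)
qed

section \<open>The residual of the regularized system\<close>

lemma norm_le_op_norm: "norm (A *v v) \<le> op_norm A * norm v"
  unfolding op_norm_def by (rule onorm) (rule matrix_vector_mul_bounded_linear)

lemma mat_scalar_mult: "mat c *v v = c *\<^sub>R (v :: real^'n)"
  by (simp add: mat_def matrix_vector_mult_def vec_eq_iff mult_delta_left)

lemma norm_regularized_square_le: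
  fixes M :: "real^'l^'l"
  assumes "0 \<le> \<nu>"
  shows "norm ((M ** M + mat \<nu>) *v v) \<le> ((op_norm M)\<^sup>2 + \<nu>) * norm v"
proof -
  have "0 \<le> op_norm M"
    unfolding op_norm_def by (rule onorm_pos_le) (rule matrix_vector_mul_bounded_linear)
  then have "norm (M *v (M *v v)) \<le> op_norm M * (op_norm M * norm v)"
    by (meson norm_le_op_norm mult_left_mono order_trans)
  moreover have "norm ((M ** M + mat \<nu>) *v v) \<le> norm (M *v (M *v v)) + \<nu> * norm v"
    using assms norm_triangle_ineq[of "M *v (M *v v)" "\<nu> *\<^sub>R v"]
    by (simp add: matrix_vector_mult_add_rdistrib matrix_vector_mul_assoc mat_scalar_mult)
  ultimately show ?thesis by (simp add: power2_eq_square algebra_simps)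
qed

text \<open>
  \<open>M S w + b\<close> is the projected residual. Because \<open>S\<close> commutes with \<open>M\<close>, applying \<open>M\<^sup>2 + \<nu> I\<close> to the
  first summand gives \<open>M S (- S b) = - M\<^sup>2 b\<close>, which cancels against \<open>M\<^sup>2 b\<close> from the second. No inverse
  of \<open>S\<close> or of \<open>M\<^sup>2 + \<nu> I\<close> is formed, so singular \<open>M\<close> and \<open>\<nu> = 0\<close> are covered.
\<close>

lemma regularized_residual_eq:
  fixes M S :: "real^'l^'l"
  assumes SS: "S ** S = M"
    and w: "(M ** M + mat \<nu>) *v w = - (S *v b)"
  shows "(M ** M + mat \<nu>) *v (M *v (S *v w) + b) = \<nu> *\<^sub>R b"
proof -
  have Mv: "M *v v = S *v (S *v v)" for v by (simp add: SS[symmetric] matrix_vector_mul_assoc)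
  have reg: "(M ** M + mat \<nu>) *v v = M *v (M *v v) + \<nu> *\<^sub>R v" for v
    by (simp add: matrix_vector_mult_add_rdistrib matrix_vector_mul_assoc mat_scalar_mult)
  have "(M ** M + mat \<nu>) *v (M *v (S *v w)) = M *v (S *v ((M ** M + mat \<nu>) *v w))"
    by (simp add: reg Mv matrix_vector_right_distrib matrix_vector_mult_scaleR)
  also have "\<dots> = - (M *v (M *v b))"
    by (simp add: w Mv linear_neg[OF matrix_vector_mul_linear])
  finally show ?thesis
    by (simp add: matrix_vector_right_distrib reg)
qed

theorem lemma4p3:
  fixes D :: "(real^'n) set"
    and F :: "real^'n \<Rightarrow> real^'m"
    and J :: "real^'n \<Rightarrow> real^'n^'m"
    and x :: "real^'n" and y :: "real^'m"
    and A :: "real^'n^'m" and B :: "real^'n^'n" and g :: "real^'n"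
    and m :: "real^'n \<Rightarrow> real^'n"
    and us :: "nat \<Rightarrow> real^'m" and vs :: "nat \<Rightarrow> real^'n"
    and \<alpha> \<beta> :: "nat \<Rightarrow> real"
    and Q :: "real^'l::{finite,linorder}^'n" and T S :: "real^'l::{finite,linorder}^'l::{finite,linorder}"
    and w :: "real \<Rightarrow> real^'l::{finite,linorder}" and z p :: "real \<Rightarrow> real^'n"
    and lam \<Delta> q :: real
  assumes "CARD('n) \<le> CARD('m)"
    and "cont_differentiable_with D F J"
    and "x \<in> D"
    and "A = J x"
    and "B = transpose A ** A"
    and "g = transpose A *v (F x - y)"
    and "g \<noteq> 0"
    and "\<And>v. m v = B *v v + g"
    and "CARD('l) \<le> CARD('n)"
    and "golub_kahan_lanczos A g CARD('l) us vs \<alpha> \<beta>"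
    and "\<And>j. 1 \<le> j \<Longrightarrow> j \<le> CARD('l) \<Longrightarrow> \<alpha> j \<noteq> 0"
    and "\<And>j. 1 \<le> j \<Longrightarrow> j < CARD('l) \<Longrightarrow> \<beta> j \<noteq> 0"
    and "Q = lanczos_Q vs"
    and "T = lanczos_T \<alpha> \<beta>"
    and "S = psd_sqrt (transpose T ** T)"
    and "\<And>\<mu>. 0 \<le> \<mu> \<Longrightarrow>
           ((transpose T ** T) ** (transpose T ** T) + mat \<mu>) *v w \<mu> = - (S *v (transpose Q *v g))"
    and "\<And>\<mu>. 0 \<le> \<mu> \<Longrightarrow> z \<mu> = Q *v w \<mu>"
    and "\<And>\<mu>. 0 \<le> \<mu> \<Longrightarrow> p \<mu> = Q *v (S *v (transpose Q *v z \<mu>))"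
    and "0 \<le> lam"
    and "lam * (\<Delta> - norm (w lam)) = 0"
    and "norm (w lam) \<le> \<Delta>"
    and "0 < q" and "q < 1"
    and "0 < \<Delta>"
    and "\<Delta> \<le> (1 - q) * (norm (S *v (transpose Q *v g)) / (op_norm (transpose T ** T))\<^sup>2)"
  shows "norm (transpose Q *v m (p lam)) \<ge> q * norm g"
proof -
  note gkl = assms(10)
  define M where "M = transpose T ** T"
  define b where "b = transpose Q *v g"
  define P :: "real^'l::{finite,linorder}^'m" where "P = lanczos_Q us"
  note orth = golub_kahan_lanczos_orthonormal[OF gkl \<open>g \<noteq> 0\<close> assms(11,12)]
  have QQ: "transpose Q ** Q = mat 1"
    unfolding \<open>Q = lanczos_Q vs\<close> by (rule lanczos_Q_orthonormal) (rule orth(2))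
  have PP: "transpose P ** P = mat 1"
    unfolding P_def by (rule lanczos_Q_orthonormal) (rule orth(1))
  have AQ: "A ** Q = P ** T"
    unfolding P_def \<open>Q = _\<close> \<open>T = _\<close> by (rule lanczos_factorization[OF gkl])
  have QBQ: "transpose Q ** (B ** Q) = M"
  proof -
    have "transpose Q ** (B ** Q) = transpose (A ** Q) ** (A ** Q)"
      unfolding \<open>B = _\<close> matrix_transpose_mul by (simp add: matrix_mul_assoc)
    also have "\<dots> = transpose T ** (transpose P ** P) ** T"
      unfolding AQ matrix_transpose_mul by (simp add: matrix_mul_assoc)
    finally show ?thesis by (simp add: PP M_def)
  qed
  have SS: "S ** S = M"
    unfolding \<open>S = _\<close> M_def by (rule psd_sqrt_square[OF psd_gram])
  have weq: "(M ** M + mat lam) *v w lam = - (S *v b)"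
    using assms(16)[OF \<open>0 \<le> lam\<close>] by (simp add: M_def b_def)
  define r where "r = transpose Q *v m (p lam)"
  have "p lam = Q *v (S *v w lam)"
    using assms(17,18)[OF \<open>0 \<le> lam\<close>] QQ by (simp add: matrix_vector_mul_assoc)
  then have r: "r = M *v (S *v w lam) + b"
    by (simp add: r_def b_def assms(8) QBQ[symmetric] matrix_vector_right_distrib matrix_vector_mul_assoc
        matrix_mul_assoc)
  \<comment> \<open>The component of \<open>b\<close> along the first Lanczos vector is already \<open>norm g\<close>.\<close>
  have gb: "norm g \<le> norm b"
  proof -
    obtain i :: 'l where i: "pos i = 1"
    proof -
      have "1 \<in> range (pos :: 'l \<Rightarrow> nat)"
        using bij_betw_pos[where 'l='l] by (simp add: bij_betw_def Suc_le_eq)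
      then show ?thesis using that by (metis rangeE)
    qed
    have "b $ i = vs 1 \<bullet> g"
      by (simp add: b_def \<open>Q = _\<close> lanczos_Q_def transpose_def matrix_vector_mult_def inner_vec_def i)
    also have "\<dots> = norm g"
      using gkl \<open>g \<noteq> 0\<close> by (simp add: golub_kahan_lanczos_def power2_norm_eq_inner[symmetric] power2_eq_square)
    finally show ?thesis using component_le_norm_cart[of b i] by simp
  qed
  define N where "N = (op_norm M)\<^sup>2"
  have Delta: "\<Delta> \<le> (1 - q) * (norm (S *v b) / N)"
    using assms(25) by (simp add: M_def b_def N_def)
  \<comment> \<open>Division by zero yields zero, so positivity of \<open>\<Delta>\<close> excludes both \<open>N = 0\<close> and \<open>S b = 0\<close>.\<close>
  have "0 < (1 - q) * (norm (S *v b) / N)" using Delta \<open>0 < \<Delta>\<close> by linarith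
  then have N: "0 < N" and Sb: "0 < norm (S *v b)"
    using \<open>q < 1\<close> by (auto simp: N_def zero_less_mult_iff zero_less_divide_iff)
  have "norm (S *v b) \<le> (N + lam) * norm (w lam)"
    using norm_regularized_square_le[OF \<open>0 \<le> lam\<close>, of M "w lam"] weq by (simp add: N_def)
  also have "\<dots> \<le> (N + lam) * \<Delta>"
    using N \<open>0 \<le> lam\<close> assms(21) by (intro mult_left_mono) auto
  also have "\<dots> \<le> (N + lam) * ((1 - q) * (norm (S *v b) / N))"
    using N \<open>0 \<le> lam\<close> Delta by (intro mult_left_mono) auto
  finally have "N * norm (S *v b) \<le> ((N + lam) * (1 - q)) * norm (S *v b)"
    using N by (simp add: field_simps)
  then have "N \<le> (N + lam) * (1 - q)"
    using Sb by (rule mult_right_le_imp_le)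
  then have lam: "q * (N + lam) \<le> lam"
    by (simp add: algebra_simps)
  have "(N + lam) * (q * norm b) = (q * (N + lam)) * norm b" by simp
  also have "\<dots> \<le> lam * norm b" using lam by (rule mult_right_mono) simp
  also have "\<dots> = norm ((M ** M + mat lam) *v r)"
    unfolding r regularized_residual_eq[OF SS weq] using \<open>0 \<le> lam\<close> by simp
  also have "\<dots> \<le> (N + lam) * norm r"
    unfolding N_def by (rule norm_regularized_square_le[OF \<open>0 \<le> lam\<close>])
  finally have "q * norm b \<le> norm r"
    using N \<open>0 \<le> lam\<close> by simp
  moreover have "q * norm g \<le> q * norm b"
    using gb \<open>0 < q\<close> by simp
  ultimately show ?thesis by (simp add: r_def)
qed

end
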